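(* For $\operatorname{Re}(\mu+\nu)<1$, $\operatorname{Re}x>0$, $x>0$, $\operatorname{Re}y>0$, $y>0$, $$ \begin{aligned} &\int_0^\infty t^{-(\mu+\nu)}\exp\left(-\frac{x+y}{4xy}t^2\right){}_2F_2\left(-\mu,-\nu;-\frac{\mu+\nu}{2},\frac{1-\mu-\nu}{2};\frac{t^2}{8x}\right)dt\\ &=2^{-(\mu+\nu)}\,\Gamma\left[\frac{1-\mu-\nu}{2}\right]y\left(\frac{x+y}{xy}\right)^{(1+\mu+\nu)/2}\left\{{}_2F_1\left(-\frac{\mu}{2},-\frac{1+\nu}{2};-\frac{\mu+\nu}{2};\frac{y(2x+y)}{(x+y)^2}\right)\right.\\ &\qquad\left.-\frac{\nu y}{(\mu+\nu)(x+y)}\,{}_2F_1\left(-\frac{\mu}{2},\frac{1-\nu}{2};1-\frac{\mu+\nu}{2};\frac{y(2x+y)}{(x+y)^2}\right)\right\}. \end{aligned} $$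
   Context: $\mu$ and $\nu$ are complex numbers. $\Gamma[\cdot]$ is the gamma function, ${}_2F_1(a,b;c;z)$ is the Gaussian hypergeometric function, and ${}_2F_2(a_1,a_2;b_1,b_2;z)=\sum_{n\ge0}\frac{(a_1)_n(a_2)_n}{(b_1)_n(b_2)_n}\frac{z^n}{n!}$ is the generalized hypergeometric function. *)

theory Defs
  imports "HOL-Analysis.Analysis"
begin

text \<open>
  The value at \<open>z\<close> of the generalized hypergeometric series with upper parameters \<open>as\<close> and lower
  parameters \<open>bs\<close>. It is meaningful where the series converges (every \<open>z\<close> for \<open>2F2\<close>, the open
  unit disc for \<open>2F1\<close>) and no lower parameter is a nonpositive integer.
\<close>
definition hypergeo :: "complex list \<Rightarrow> complex list \<Rightarrow> complex \<Rightarrow> complex" where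
  "hypergeo as bs z = eval_fps (fps_hypergeo as bs 1) z"

abbreviation hypergeo_2F1 :: "complex \<Rightarrow> complex \<Rightarrow> complex \<Rightarrow> complex \<Rightarrow> complex" where
  "hypergeo_2F1 a b c z \<equiv> hypergeo [a, b] [c] z"

abbreviation hypergeo_2F2 ::
  "complex \<Rightarrow> complex \<Rightarrow> complex \<Rightarrow> complex \<Rightarrow> complex \<Rightarrow> complex" where
  "hypergeo_2F2 a1 a2 b1 b2 z \<equiv> hypergeo [a1, a2] [b1, b2] z"

lemma hypergeo_2F1_series:
  "hypergeo_2F1 a b c z =
     (\<Sum>n. (pochhammer a n * pochhammer b n) / pochhammer c n * (z ^ n / fact n))"
  by (simp add: hypergeo_def eval_fps_def)

lemma hypergeo_2F2_series:
  "hypergeo_2F2 a1 a2 b1 b2 z =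
     (\<Sum>n. (pochhammer a1 n * pochhammer a2 n) / (pochhammer b1 n * pochhammer b2 n)
            * (z ^ n / fact n))"
  by (simp add: hypergeo_def eval_fps_def)

end

theory Submission
  imports Defs "HOL-Complex_Analysis.Complex_Analysis"
begin

text \<open>
  Termwise integration against the Gaussian turns the \<open>2F2\<close> into \<open>2F1(-\<mu>, -\<nu>; -(\<mu> + \<nu>)/2; w)\<close>
  with \<open>w = y / (2 (x + y))\<close>. Its lower parameter is half the sum \<open>a + b\<close> of the upper ones; a contiguous
  relation expresses it through two \<open>2F1\<close> whose lower parameter is \<open>(a + b + 1)/2\<close> in terms of
  their own upper parameters. To these the quadratic transformation
  \<open>2F1(a, b; (a + b + 1)/2; w) = 2F1(a/2, b/2; (a + b + 1)/2; 4 w (1 - w))\<close> applies. That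
  transformation holds for formal power series, since both sides satisfy the same hypergeometric
  differential equation, and extends to \<open>0 \<le> w < 1/2\<close> by analytic continuation in \<open>z = 4 w (1 - w)\<close>.
\<close>

unbundle no vec_syntax

section \<open>Formal power series: the hypergeometric equation and the quadratic
  transformation\<close>

lemma nonpos_Ints_of_nat_add: "c \<notin> \<int>\<^sub>\<le>\<^sub>0 \<Longrightarrow> (c::complex) + of_nat n \<noteq> 0"
  using plus_of_nat_eq_0_imp by blast

lemma fps_hypergeo_2F1_Suc:
  fixes a b c :: complex
  assumes "c \<notin> \<int>\<^sub>\<le>\<^sub>0"
  shows "of_nat (Suc n) * (c + of_nat n) * fps_hypergeo [a, b] [c] 1 $ Suc n =
         (a + of_nat n) * (b + of_nat n) * fps_hypergeo [a, b] [c] 1 $ n"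
proof -
  have "of_nat (Suc n) * (c + of_nat n) \<noteq> (0 :: complex)"
    using nonpos_Ints_of_nat_add[OF assms, of n] by (simp del: of_nat_Suc)
  then show ?thesis
    by (simp add: fps_hypergeo_rec del: fps_hypergeo_nth of_nat_Suc)
qed

text \<open>Gauss's differential operator. On formal power series a change of variable is a
  composition, so no convergence has to be checked.\<close>

definition hypergeo_op :: "complex \<Rightarrow> complex \<Rightarrow> complex \<Rightarrow> complex fps \<Rightarrow> complex fps" where
  "hypergeo_op a b c f = fps_X * (1 - fps_X) * fps_deriv (fps_deriv f)
     + (fps_const c - fps_const (a + b + 1) * fps_X) * fps_deriv f - fps_const (a * b) * f"

text \<open>The terms without an extra factor z give n + c times (n + 1) f_(n+1); the others give
  n(n - 1) + (a + b + 1) n + ab = (a + n)(b + n). The equation is thus the two-term hypergeometric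
  recurrence.\<close>

lemma hypergeo_op_nth:
  "hypergeo_op a b c f $ n =
     of_nat (Suc n) * (c + of_nat n) * f $ Suc n - (a + of_nat n) * (b + of_nat n) * f $ n"
proof -
  have *: "hypergeo_op a b c f = fps_X * fps_deriv (fps_deriv f)
      - fps_X * (fps_X * fps_deriv (fps_deriv f)) + fps_const c * fps_deriv f
      - fps_const (a + b + 1) * (fps_X * fps_deriv f) - fps_const (a * b) * f"
    by (simp add: hypergeo_op_def algebra_simps)
  show ?thesis
  proof (cases n)
    case (Suc m)
    then show ?thesis
      unfolding * by (cases m) (simp_all add: algebra_simps)
  qed (simp add: *)
qed

lemma hypergeo_op_fps_hypergeo:
  assumes "c \<notin> \<int>\<^sub>\<le>\<^sub>0"
  shows "hypergeo_op a b c (fps_hypergeo [a, b] [c] 1) = 0"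
  unfolding fps_eq_iff hypergeo_op_nth fps_hypergeo_2F1_Suc[OF assms] by simp

text \<open>The factor (n + 1)(c + n) never vanishes, so the recurrence determines every coefficient
  from the constant term. An identity of series then reduces to checking a differential
  equation.\<close>

lemma hypergeo_op_unique:
  assumes "hypergeo_op a b c f = 0" "f $ 0 = 1" "c \<notin> \<int>\<^sub>\<le>\<^sub>0"
  shows "f = fps_hypergeo [a, b] [c] 1"
proof (rule fps_ext)
  fix n
  show "f $ n = fps_hypergeo [a, b] [c] 1 $ n"
  proof (induction n)
    case (Suc n)
    have "of_nat (Suc n) * (c + of_nat n) * f $ Suc n = (a + of_nat n) * (b + of_nat n) * f $ n"
      using arg_cong[OF assms(1), of "\<lambda>g. g $ n"] by (simp add: hypergeo_op_nth)
    with Suc fps_hypergeo_2F1_Suc[OF assms(3), of n a b]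
    have "of_nat (Suc n) * (c + of_nat n) * f $ Suc n
        = of_nat (Suc n) * (c + of_nat n) * fps_hypergeo [a, b] [c] 1 $ Suc n" by simp
    moreover have "of_nat (Suc n) * (c + of_nat n) \<noteq> (0 :: complex)"
      using nonpos_Ints_of_nat_add[OF assms(3), of n] by (simp del: of_nat_Suc)
    ultimately show ?case using mult_left_cancel by blast
  qed (use assms in simp)
qed

text \<open>For z = 4 X (1 - X) one has (1 - 2 X)^2 = 1 - z. The choice of \<open>c\<close> makes
  the equation with parameters a/2, b/2 in z pull back to the one with a, b in X, and uniqueness
  concludes.\<close>

lemma fps_hypergeo_quadratic:
  fixes a b :: complex
  defines "c \<equiv> (a + b + 1) / 2"
  assumes "c \<notin> \<int>\<^sub>\<le>\<^sub>0"
  shows "fps_hypergeo [a / 2, b / 2] [c] 1 oo (fps_const 4 * fps_X * (1 - fps_X)) =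
         fps_hypergeo [a, b] [c] 1"
proof (rule hypergeo_op_unique)
  define h where "h = fps_hypergeo [a / 2, b / 2] [c] (1::complex)"
  define z :: "complex fps" where "z = fps_const 4 * fps_X * (1 - fps_X)"
  have z0: "z $ 0 = 0" by (simp add: z_def)
  have dz: "fps_deriv z = fps_const 4 * (1 - 2 * fps_X)"
    by (simp add: z_def algebra_simps)
  \<comment> \<open>These are kept as independent unknowns, which leaves a polynomial identity to
    verify.\<close>
  define h0 h1 h2 where "h0 = h oo z" "h1 = fps_deriv h oo z" "h2 = fps_deriv (fps_deriv h) oo z"
  have d1: "fps_deriv (h oo z) = h1 * fps_deriv z"
    using z0 by (simp add: fps_compose_deriv h0_h1_h2_def)
  have dz2: "fps_deriv z = 4 * (1 - 2 * fps_X)" "fps_deriv (fps_deriv z) = - 8"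
    unfolding dz by (simp_all add: numeral_fps_const)
  have d2: "fps_deriv (fps_deriv (h oo z)) =
     h2 * (4 * (1 - 2 * fps_X)) * (4 * (1 - 2 * fps_X)) - 8 * h1"
    unfolding d1 fps_deriv_mult dz2(2) using z0
    by (simp add: fps_compose_deriv h0_h1_h2_def dz2(1) algebra_simps)
  have "hypergeo_op (a / 2) (b / 2) c h oo z = 0"
    using assms by (simp add: h_def hypergeo_op_fps_hypergeo)
  then have ode: "z * (1 - z) * h2 + (fps_const c - fps_const (a / 2 + b / 2 + 1) * z) * h1
       - fps_const (a / 2 * (b / 2)) * h0 = 0"
    using z0 by (simp add: hypergeo_op_def h0_h1_h2_def fps_compose_mult_distrib
        fps_compose_sub_distrib fps_compose_add_distrib del: fps_const_mult fps_const_add)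
  have c: "fps_const (a + b + 1) = 2 * fps_const c"
    "fps_const (a / 2 + b / 2 + 1) = fps_const c + fps_const (1/2)"
    "fps_const (a * b) = 4 * fps_const (a / 2 * (b / 2))"
    by (simp_all add: c_def field_simps flip: numeral_fps_const)
  have half: "2 * fps_const (1/2 :: complex) = 1"
    by (simp flip: numeral_fps_const)
  have z: "z = 4 * fps_X * (1 - fps_X)"
    by (simp add: z_def numeral_fps_const)
  \<comment> \<open>The second-order terms agree because X (1 - X) z'^2 = 4 z (1 - z), the
    first-order ones because 2 c = a + b + 1.\<close>
  have "hypergeo_op a b c (h oo z) = 4 * (z * (1 - z) * h2
       + (fps_const c - fps_const (a / 2 + b / 2 + 1) * z) * h1 - fps_const (a / 2 * (b / 2)) * h0)"
    unfolding hypergeo_op_def d2 unfolding d1 unfolding dz2(1) c h0_h1_h2_def(1)[symmetric]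
    using half z by algebra
  also have "\<dots> = 0" unfolding ode by simp
  finally show "hypergeo_op a b c (fps_hypergeo [a / 2, b / 2] [c] 1 oo
      (fps_const 4 * fps_X * (1 - fps_X))) = 0"
    by (simp only: h_def z_def)
qed (use assms in simp_all)

text \<open>Both series on the right have half of one plus the sum of their upper parameters as
  lower parameter, the shape required by the quadratic transformation. The proof compares
  coefficients.\<close>

lemma fps_hypergeo_contiguous:
  fixes a b :: complex
  defines "c \<equiv> (a + b) / 2"
  assumes "c \<notin> \<int>\<^sub>\<le>\<^sub>0"
  shows "(1 - 2 * fps_X) * fps_hypergeo [a, b] [c] 1 = fps_hypergeo [a, b - 1] [c] 1
           - fps_const (b / c) * (fps_X * fps_hypergeo [a, b + 1] [c + 1] 1)"
proof (rule fps_ext)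
  fix n
  show "((1 - 2 * fps_X) * fps_hypergeo [a, b] [c] 1) $ n = (fps_hypergeo [a, b - 1] [c] 1
           - fps_const (b / c) * (fps_X * fps_hypergeo [a, b + 1] [c + 1] 1)) $ n"
  proof (cases n)
    case (Suc m)
    define A B C where "A = pochhammer a m" "B = pochhammer b m" "C = pochhammer c m"
    have c0: "c \<noteq> 0" using assms by auto
    have cm: "c + of_nat m \<noteq> 0" using nonpos_Ints_of_nat_add assms by blast
    have C0: "C \<noteq> 0"
      using assms unfolding A_B_C_def pochhammer_eq_0_iff by auto
    have m0: "of_nat (Suc m) \<noteq> (0::complex)" by (simp del: of_nat_Suc)
    have pb: "pochhammer (b - 1) (Suc m) = (b - 1) * B"
      by (simp add: pochhammer_rec A_B_C_def)
    \<comment> \<open>Both sides are the Pochhammer symbol of \<open>b\<close> at m + 1, split off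
      at its first or at its last factor.\<close>
    have pb1: "b * pochhammer (b + 1) m = B * (b + of_nat m)"
      using pochhammer_rec[of b m] pochhammer_Suc[of b m] by (simp add: A_B_C_def)
    have pc1: "c * pochhammer (c + 1) m = C * (c + of_nat m)"
      using pochhammer_rec[of c m] pochhammer_Suc[of c m] by (simp add: A_B_C_def)
    have "2 * c = a + b" by (simp add: c_def)
    then have ab: "a = 2 * c - b" by simp
    have "b / c * (A * pochhammer (b + 1) m / (pochhammer (c + 1) m * fact m)) =
         A * (b * pochhammer (b + 1) m) / ((c * pochhammer (c + 1) m) * fact m)" by (simp add: mult_ac)
    also have "\<dots> = A * (B * (b + of_nat m)) / (C * (c + of_nat m) * fact m)"
      unfolding pb1 pc1 ..
    finally have last: "b / c * (A * pochhammer (b + 1) m / (pochhammer (c + 1) m * fact m)) =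
      A * (B * (b + of_nat m)) / (C * (c + of_nat m) * fact m)" .
    define Q N :: complex where Q_N: "Q = c + of_nat m" "N = of_nat (Suc m)"
    have Q0: "Q \<noteq> 0" and N0: "N \<noteq> 0" unfolding Q_N by (fact cm, fact m0)
    \<comment> \<open>What remains after dividing by the common factor: the sides agree because (a +
      m)(m + 1) = (m + 1)(2 c - b + m).\<close>
    have "(a + of_nat m) * (b + of_nat m) - 2 * of_nat (Suc m) * (c + of_nat m)
        = (a + of_nat m) * (b - 1) - of_nat (Suc m) * (b + of_nat m)"
      unfolding ab of_nat_Suc by (simp add: algebra_simps)
    then have "A * B / (C * Q * (N * fact m)) * ((a + of_nat m) * (b + of_nat m) - 2 * N * Q)
        = A * B / (C * Q * (N * fact m)) * ((a + of_nat m) * (b - 1) - N * (b + of_nat m))"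
      by (simp only: Q_N)
    then have key: "A * (a + of_nat m) * (B * (b + of_nat m)) / (C * Q * (N * fact m)) - 2 * (A * B / (C * fact m))
        = A * (a + of_nat m) * ((b - 1) * B) / (C * Q * (N * fact m))
           - A * (B * (b + of_nat m)) / (C * Q * fact m)"
      unfolding right_diff_distrib[of "A * B / _"] using Q0 N0 by (simp add: mult_ac)
    have "fps_hypergeo [a, b] [c] 1 $ Suc m = A * (a + of_nat m) * (B * (b + of_nat m)) / (C * Q * (N * fact m))"
      "fps_hypergeo [a, b - 1] [c] 1 $ Suc m = A * (a + of_nat m) * ((b - 1) * B) / (C * Q * (N * fact m))"
      by (simp_all add: pb pochhammer_Suc[of a] pochhammer_Suc[of b] pochhammer_Suc[of c] A_B_C_def Q_N distrib_right)
    moreover have "fps_hypergeo [a, b] [c] 1 $ m = A * B / (C * fact m)"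
      by (simp add: A_B_C_def)
    moreover have "fps_hypergeo [a, b + 1] [c + 1] 1 $ m = A * pochhammer (b + 1) m / (pochhammer (c + 1) m * fact m)"
      by (simp add: A_B_C_def)
    ultimately show ?thesis
      using key unfolding last[symmetric, folded Q_N(1)] Suc
      by (simp add: left_diff_distrib mult.assoc numeral_fps_const del: fps_hypergeo_nth)
  qed simp
qed

section \<open>Convergence and analyticity of the hypergeometric series\<close>

lemma summable_norm_ratio_tendsto:
  fixes f :: "nat \<Rightarrow> complex"
  assumes "\<And>n. f (Suc n) = r n * f n" "r \<longlonglongrightarrow> l" "norm l < 1"
  shows "summable (\<lambda>n. norm (f n))"
proof -
  obtain q where q: "norm l < q" "q < 1" using dense assms(3) by blast
  have "(\<lambda>n. norm (r n)) \<longlonglongrightarrow> norm l" by (intro tendsto_norm assms)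
  then have "\<forall>\<^sub>F n in sequentially. norm (r n) < q" using q by (simp add: order_tendstoD)
  then obtain N where N: "\<And>n. n \<ge> N \<Longrightarrow> norm (r n) < q"
    unfolding eventually_sequentially by blast
  show ?thesis
  proof (rule summable_ratio_test[OF q(2)])
    \<comment> \<open>The recurrence multiplies by \<open>r n\<close> and never divides by
      \<open>f n\<close>, so the zero terms of a terminating series do no harm.\<close>
    show "norm (norm (f (Suc n))) \<le> q * norm (norm (f n))" if "n \<ge> N" for n
      using N[OF that] by (simp add: assms(1) norm_mult mult_right_mono)
  qed
qed

lemma tendsto_shifted_nat_quotient:
  fixes u v :: complex
  shows "(\<lambda>n. (u + of_nat n) / (v + of_nat n)) \<longlonglongrightarrow> 1"
proof -
  have 1: "(\<lambda>n. (u / of_nat n + 1) / (v / of_nat n + 1)) \<longlonglongrightarrow> (0 + 1) / (0 + 1)"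
    by (intro tendsto_intros lim_const_over_n) auto
  have "\<forall>\<^sub>F n in sequentially. (u / of_nat n + 1) / (v / of_nat n + 1) = (u + of_nat n) / (v + of_nat n)"
    using eventually_gt_at_top[of 0]
  proof eventually_elim
    case (elim n)
    have "u / of_nat n + 1 = (u + of_nat n) / of_nat n" "v / of_nat n + 1 = (v + of_nat n) / of_nat n"
      using elim by (simp_all add: field_simps)
    with elim show ?case by simp
  qed
  with 1 show ?thesis by (simp add: tendsto_cong)
qed

lemma summable_norm_hypergeo_2F1:
  fixes a b c z :: complex
  assumes "norm z < 1"
  shows "summable (\<lambda>n. norm (fps_hypergeo [a, b] [c] 1 $ n * z ^ n))"
proof (rule summable_norm_ratio_tendsto)
  \<comment> \<open>Division by zero yields 0, so the recurrence persists for a nonpositive integer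
    \<open>c\<close>: the factor vanishes at n = -c, as do all later coefficients.\<close>
  show "fps_hypergeo [a, b] [c] 1 $ Suc n * z ^ Suc n
      = (a + of_nat n) / (c + of_nat n) * ((b + of_nat n) / (1 + of_nat n)) * z
        * (fps_hypergeo [a, b] [c] 1 $ n * z ^ n)" for n
    by (simp add: fps_hypergeo_rec mult_ac del: fps_hypergeo_nth)
  show "(\<lambda>n. (a + of_nat n) / (c + of_nat n) * ((b + of_nat n) / (1 + of_nat n)) * z) \<longlonglongrightarrow> 1 * 1 * z"
    by (intro tendsto_intros tendsto_shifted_nat_quotient)
qed (use assms in simp)

text \<open>With equally many upper and lower parameters the factor 1/n! is left over, so the ratio
  of consecutive terms tends to 0 for every \<open>z\<close>.\<close>

lemma summable_norm_hypergeo_2F2: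
  fixes a b c d z :: complex
  shows "summable (\<lambda>n. norm (fps_hypergeo [a, b] [c, d] 1 $ n * z ^ n))"
proof (rule summable_norm_ratio_tendsto)
  show "fps_hypergeo [a, b] [c, d] 1 $ Suc n * z ^ Suc n
      = (a + of_nat n) / (c + of_nat n) * ((b + of_nat n) / (d + of_nat n)) * (z * inverse (of_nat (Suc n)))
        * (fps_hypergeo [a, b] [c, d] 1 $ n * z ^ n)" for n
    by (simp add: fps_hypergeo_rec divide_inverse mult_ac del: fps_hypergeo_nth)
  show "(\<lambda>n. (a + of_nat n) / (c + of_nat n) * ((b + of_nat n) / (d + of_nat n))
      * (z * inverse (of_nat (Suc n)))) \<longlonglongrightarrow> 1 * 1 * (z * 0)"
    by (intro tendsto_intros tendsto_shifted_nat_quotient LIMSEQ_Suc[OF lim_inverse_n])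
qed simp

lemma fps_conv_radius_hypergeo_2F1:
  fixes a b c :: complex
  shows "fps_conv_radius (fps_hypergeo [a, b] [c] 1) \<ge> 1"
  unfolding fps_conv_radius_def
proof (rule conv_radius_geI_ex)
  fix r :: real assume r: "0 < r" "ereal r < 1"
  have "r < 1" using r by (simp add: one_ereal_def)
  then show "\<exists>z. norm z = r \<and> summable (\<lambda>n. fps_hypergeo [a, b] [c] 1 $ n * z ^ n)"
    using r summable_norm_cancel[OF summable_norm_hypergeo_2F1[of "of_real r" a b c]]
    by (intro exI[of _ "of_real r"]) simp
qed

text \<open>The inner function \<open>f\<close> covers both the plain series and its composition
  with a branch of the square root below.\<close>

lemma hypergeo_2F1_holomorphic:
  assumes "f holomorphic_on A" "\<And>z. z \<in> A \<Longrightarrow> norm (f z) < 1"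
  shows "(\<lambda>z. hypergeo_2F1 a b c (f z)) holomorphic_on A"
proof -
  have "eval_fps (fps_hypergeo [a, b] [c] 1) holomorphic_on ball 0 1"
  proof (intro holomorphic_on_eval_fps subsetI)
    fix x :: complex assume "x \<in> ball 0 1"
    then have "ereal (norm x) < 1" by (simp add: one_ereal_def)
    also have "\<dots> \<le> fps_conv_radius (fps_hypergeo [a, b] [c] 1)"
      by (rule fps_conv_radius_hypergeo_2F1)
    finally show "x \<in> eball 0 (fps_conv_radius (fps_hypergeo [a, b] [c] 1))"
      by (simp add: in_eball_iff)
  qed
  moreover have "f ` A \<subseteq> ball 0 1" using assms(2) by auto
  ultimately show ?thesis
    using holomorphic_on_compose_gen[OF assms(1)] by (simp add: hypergeo_def o_def)
qed

section \<open>From formal identities to identities of functions\<close>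

lemma hypergeo_2F1_has_fps_expansion: "hypergeo_2F1 a b c has_fps_expansion fps_hypergeo [a, b] [c] 1"
proof -
  have "0 < fps_conv_radius (fps_hypergeo [a, b] [c] 1)"
    by (rule less_le_trans[OF _ fps_conv_radius_hypergeo_2F1]) simp
  then show ?thesis by (simp add: has_fps_expansion_def hypergeo_def)
qed

text \<open>In the variable z = 4 w (1 - w) both sides are holomorphic on the whole unit disc, which
  is connected. The formal identity gives agreement near 0, and analytic continuation gives the
  rest.\<close>

lemma hypergeo_2F1_quadratic_csqrt:
  assumes "(a + b + 1) / 2 \<notin> \<int>\<^sub>\<le>\<^sub>0" "norm z < 1"
  shows "hypergeo_2F1 a b ((a + b + 1) / 2) ((1 - csqrt (1 - z)) / 2)
       = hypergeo_2F1 (a / 2) (b / 2) ((a + b + 1) / 2) z"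
proof -
  define c where "c = (a + b + 1) / 2"
  \<comment> \<open>The inverse branch of w \<mapsto> 4 w (1 - w) that fixes 0.\<close>
  define g where "g = (\<lambda>z. (1 - csqrt (1 - z)) / 2)"
  have Re1: "Re (1 - z) > 0" if "norm z < 1" for z :: complex
    using that abs_Re_le_cmod[of z] by simp
  have "1 - z \<notin> \<real>\<^sub>\<le>\<^sub>0" if "norm z < 1" for z :: complex
    using Re1[OF that] by (auto simp: complex_nonpos_Reals_iff)
  then have g_hol: "g holomorphic_on ball 0 1"
    unfolding g_def by (intro holomorphic_intros) auto
  \<comment> \<open>A root u with Re u \<ge> 0 and |u|^2 < 2 satisfies |1 - u|^2 \<le> 1 + |u|^2 <
    4, so the branch stays in the disc of convergence.\<close>
  have g_norm: "norm (g z) < 1" if "norm z < 1" for z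
  proof -
    define u where "u = csqrt (1 - z)"
    have "Re u \<ge> 0" unfolding u_def by (rule Re_csqrt)
    have "(norm u)\<^sup>2 = norm (1 - z)" by (simp add: u_def flip: norm_power)
    also have "\<dots> \<le> 1 + norm z" using norm_triangle_ineq4[of 1 z] by simp
    also have "\<dots> < 2" using that by simp
    finally have "(norm u)\<^sup>2 < 2" .
    have "(norm (1 - u))\<^sup>2 = 1 - 2 * Re u + (norm u)\<^sup>2"
      unfolding cmod_power2 by (simp add: power2_eq_square algebra_simps)
    also have "\<dots> < 2\<^sup>2" using \<open>Re u \<ge> 0\<close> \<open>(norm u)\<^sup>2 < 2\<close> by simp
    finally have "norm (1 - u) < 2" by (rule power_less_imp_less_base) simp
    then show ?thesis by (simp add: g_def u_def norm_divide)
  qed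
  define h where "h = (\<lambda>w::complex. 4 * w * (1 - w))"
  have hg: "h (g z) = z" for z
  proof -
    have "h (g z) = 1 - (csqrt (1 - z))\<^sup>2"
      unfolding h_def g_def by (simp add: power2_eq_square field_simps)
    then show ?thesis by simp
  qed
  have "h has_fps_expansion fps_const 4 * fps_X * (1 - fps_X)"
    unfolding h_def by (intro fps_expansion_intros)
  then have "(hypergeo_2F1 (a / 2) (b / 2) c \<circ> h) has_fps_expansion
      (fps_hypergeo [a / 2, b / 2] [c] 1 oo (fps_const 4 * fps_X * (1 - fps_X)))"
    by (intro has_fps_expansion_compose hypergeo_2F1_has_fps_expansion) simp_all
  also have "(fps_hypergeo [a / 2, b / 2] [c] 1 oo (fps_const 4 * fps_X * (1 - fps_X)))
      = fps_hypergeo [a, b] [c] 1"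
    using assms unfolding c_def by (intro fps_hypergeo_quadratic)
  finally have "\<forall>\<^sub>F w in nhds 0. eval_fps (fps_hypergeo [a, b] [c] 1) w = hypergeo_2F1 (a / 2) (b / 2) c (h w)"
    by (simp add: has_fps_expansion_def)
  then have "\<forall>\<^sub>F w in nhds 0. hypergeo_2F1 a b c w = hypergeo_2F1 (a / 2) (b / 2) c (h w)"
    by (simp add: hypergeo_def)
  \<comment> \<open>Continuity with g(0) = 0 pulls the identity near w = 0 back to z near 0.\<close>
  moreover have "filterlim g (nhds 0) (nhds 0)"
  proof -
    have "g 0 = 0" by (simp add: g_def)
    have "isCont g 0"
      using holomorphic_on_imp_continuous_on[OF g_hol] by (simp add: continuous_on_eq_continuous_at)
    then have "filterlim g (nhds (g 0)) (nhds 0)"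
      unfolding isCont_def tendsto_at_iff_tendsto_nhds .
    then show ?thesis by (simp add: \<open>g 0 = 0\<close>)
  qed
  ultimately have "\<forall>\<^sub>F z in nhds 0. hypergeo_2F1 a b c (g z) = hypergeo_2F1 (a / 2) (b / 2) c (h (g z))"
    by (rule eventually_compose_filterlim)
  then obtain e where e: "e > 0" "\<And>z. z \<in> ball 0 e \<Longrightarrow> hypergeo_2F1 a b c (g z) = hypergeo_2F1 (a / 2) (b / 2) c z"
    unfolding eventually_nhds_metric hg by (auto simp: dist_commute)
  have "hypergeo_2F1 a b c (g z) = hypergeo_2F1 (a / 2) (b / 2) c z"
  proof (rule analytic_continuation_open[where f = "\<lambda>z. hypergeo_2F1 a b c (g z)"
        and g = "hypergeo_2F1 (a / 2) (b / 2) c" and s = "ball 0 (min e 1)" and s' = "ball 0 1"])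
    show "(\<lambda>z. hypergeo_2F1 a b c (g z)) holomorphic_on ball 0 1"
      using g_hol g_norm by (intro hypergeo_2F1_holomorphic) auto
    show "hypergeo_2F1 (a / 2) (b / 2) c holomorphic_on ball 0 1"
      by (rule hypergeo_2F1_holomorphic) auto
  qed (use e assms in auto)
  then show ?thesis unfolding c_def g_def .
qed

text \<open>The bound w < 1/2 makes 1 - 2 w positive, so the principal root of (1 - 2 w)^2 is 1 - 2
  w and the branch returns \<open>w\<close>, not 1 - w.\<close>

lemma hypergeo_2F1_quadratic:
  fixes w :: real
  assumes "(a + b + 1) / 2 \<notin> \<int>\<^sub>\<le>\<^sub>0" "0 \<le> w" "w < 1 / 2"
  shows "hypergeo_2F1 a b ((a + b + 1) / 2) (of_real w)
       = hypergeo_2F1 (a / 2) (b / 2) ((a + b + 1) / 2) (of_real (4 * w * (1 - w)))"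
proof -
  have eq: "1 - 4 * w * (1 - w) = (1 - 2 * w)\<^sup>2" by (simp add: power2_eq_square algebra_simps)
  moreover have "(1 - 2 * w)\<^sup>2 > 0" using assms by simp
  ultimately have "4 * w * (1 - w) < 1" by linarith
  moreover have "4 * w * (1 - w) \<ge> 0" using assms by simp
  ultimately have norm: "norm (complex_of_real (4 * w * (1 - w))) < 1"
    unfolding norm_of_real by linarith
  have "(1 - of_real (4 * w * (1 - w)) :: complex) = (of_real (1 - 2 * w))\<^sup>2"
    using arg_cong[OF eq, of complex_of_real] by simp
  then have "csqrt (1 - of_real (4 * w * (1 - w))) = of_real (1 - 2 * w)"
    using assms by (simp add: csqrt_square)
  then have root: "(1 - csqrt (1 - of_real (4 * w * (1 - w)))) / 2 = of_real w"
    by simp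
  show ?thesis
    using hypergeo_2F1_quadratic_csqrt[OF assms(1) norm] unfolding root .
qed

lemma hypergeo_2F1_contiguous:
  assumes c': "(a + b) / 2 \<notin> \<int>\<^sub>\<le>\<^sub>0" and w: "norm w < 1"
  shows "(1 - 2 * w) * hypergeo_2F1 a b ((a + b) / 2) w = hypergeo_2F1 a (b - 1) ((a + b) / 2) w
       - 2 * b / (a + b) * w * hypergeo_2F1 a (b + 1) ((a + b) / 2 + 1) w"
proof -
  define c where "c = (a + b) / 2"
  define F0 F1 F2 where F: "F0 = fps_hypergeo [a, b] [c] (1 :: complex)"
    "F1 = fps_hypergeo [a, b - 1] [c] (1 :: complex)"
    "F2 = fps_hypergeo [a, b + 1] [c + 1] (1 :: complex)"
  have "ereal (norm w) < 1" using w by (simp add: one_ereal_def)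
  then have rad: "ereal (norm w) < fps_conv_radius (fps_hypergeo [a', b'] [c'] 1)" for a' b' c' :: complex
    using fps_conv_radius_hypergeo_2F1 by (rule less_le_trans)
  \<comment> \<open>Evaluation respects products and differences inside the radii of convergence, so
    the radius bound is carried along with the value.\<close>
  have X: "ereal (norm w) < fps_conv_radius (fps_const k * (fps_X * f))"
      "eval_fps (fps_const k * (fps_X * f)) w = k * (w * eval_fps f w)"
    if "ereal (norm w) < fps_conv_radius f" for k f
  proof -
    have "fps_conv_radius f \<le> fps_conv_radius (fps_X * f)"
      using fps_conv_radius_mult[of fps_X f] by simp
    with that have 1: "ereal (norm w) < fps_conv_radius (fps_X * f)" by (rule less_le_trans)
    have "fps_conv_radius (fps_X * f) \<le> fps_conv_radius (fps_const k * (fps_X * f))"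
      using fps_conv_radius_mult[of "fps_const k" "fps_X * f"] by simp
    with 1 show "ereal (norm w) < fps_conv_radius (fps_const k * (fps_X * f))" by (rule less_le_trans)
    show "eval_fps (fps_const k * (fps_X * f)) w = k * (w * eval_fps f w)"
      using that 1 by (simp add: eval_fps_mult)
  qed
  have eval: "eval_fps (f - fps_const k * (fps_X * g)) w = eval_fps f w - k * (w * eval_fps g w)"
    if "ereal (norm w) < fps_conv_radius f" "ereal (norm w) < fps_conv_radius g" for k f g
    using eval_fps_diff[OF that(1) X(1)[OF that(2), of k]] X(2)[OF that(2)] by simp
  \<comment> \<open>Both sides are brought to the shape f - k X g, so that the one rule
    \<open>eval\<close> evaluates them.\<close>
  have "F0 - fps_const 2 * (fps_X * F0) = F1 - fps_const (b / c) * (fps_X * F2)"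
    using fps_hypergeo_contiguous[OF c'] unfolding c_def[symmetric] F[symmetric]
    by (simp add: algebra_simps flip: numeral_fps_const)
  moreover have "eval_fps (F0 - fps_const 2 * (fps_X * F0)) w = eval_fps F0 w - 2 * (w * eval_fps F0 w)"
    unfolding F by (rule eval[OF rad rad])
  moreover have "eval_fps (F1 - fps_const (b / c) * (fps_X * F2)) w = eval_fps F1 w - b / c * (w * eval_fps F2 w)"
    unfolding F by (rule eval[OF rad rad])
  ultimately have "eval_fps F0 w - 2 * (w * eval_fps F0 w) = eval_fps F1 w - b / c * (w * eval_fps F2 w)"
    by metis
  moreover have "b / c = 2 * b / (a + b)" by (simp add: c_def)
  ultimately show ?thesis
    unfolding hypergeo_def c_def[symmetric] F[symmetric] by (simp add: algebra_simps)
qed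

section \<open>Gaussian moments and termwise integration\<close>

lemma gaussian_moment:
  fixes \<sigma> :: complex and p :: real
  assumes "Re \<sigma> > 0" "p > 0"
  defines "f \<equiv> \<lambda>t::real. of_real t powr (2 * \<sigma> - 1) * of_real (exp (- p * t\<^sup>2))"
  shows "f absolutely_integrable_on {0<..}"
    and "(f has_integral Gamma \<sigma> * of_real p powr (- \<sigma>) / 2) {0<..}"
proof -
  \<comment> \<open>The substitution u = p t^2, du = 2 p t dt in Euler's integral for Gamma produces
    the moment.\<close>
  define g where "g = (\<lambda>t::real. p * t\<^sup>2)"
  define h where "h = (\<lambda>u::real. of_real u powr (\<sigma> - 1) / complex_of_real (exp u))"
  have img: "g ` {0<..} = {0<..}"
  proof (intro equalityI subsetI)
    fix u :: real assume u: "u \<in> {0<..}"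
    then have "u = g (sqrt (u / p))" "sqrt (u / p) \<in> {0<..}" using assms(2) by (simp_all add: g_def)
    then show "u \<in> g ` {0<..}" by blast
  qed (use assms(2) in \<open>auto simp: g_def\<close>)
  have inj: "inj_on g {0<..}" using assms(2) by (auto simp: g_def inj_on_def power2_eq_iff)
  have der: "(g has_field_derivative 2 * p * t) (at t within {0<..})" for t
    unfolding g_def by (auto intro!: derivative_eq_intros)
  have "h absolutely_integrable_on g ` {0<..} \<and> integral (g ` {0<..}) h = Gamma \<sigma>"
    using absolutely_integrable_Gamma_integral'[OF assms(1)] Gamma_integral_complex'[OF assms(1)]
    unfolding img h_def by (auto simp: integral_unique)
  then have *: "(\<lambda>t. \<bar>2 * p * t\<bar> *\<^sub>R h (g t)) absolutely_integrable_on {0<..}"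
    "integral {0<..} (\<lambda>t. \<bar>2 * p * t\<bar> *\<^sub>R h (g t)) = Gamma \<sigma>"
    using has_absolute_integral_change_of_variables_real[of "{0<..}" g "\<lambda>t. 2 * p * t" h "Gamma \<sigma>"]
      der inj by auto
  have eq: "of_real p powr (- \<sigma>) / 2 * (\<bar>2 * p * t\<bar> *\<^sub>R h (g t)) = f t" if "t \<in> {0<..}" for t
  proof -
    have t: "t > 0" using that by simp
    have "of_real p powr (- \<sigma>) / 2 * (\<bar>2 * p * t\<bar> *\<^sub>R h (g t)) =
      of_real p powr (- \<sigma>) * of_real p * of_real t * of_real (p * t\<^sup>2) powr (\<sigma> - 1) * of_real (exp (- p * t\<^sup>2))"
      using t assms(2) by (simp add: g_def h_def scaleR_conv_of_real exp_minus field_simps)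
    also have "of_real p powr (- \<sigma>) * of_real p * of_real t * of_real (p * t\<^sup>2) powr (\<sigma> - 1)
       = of_real t powr (2 * \<sigma> - 1)"
    proof -
      \<comment> \<open>All bases are positive reals, so the powers are exponentials of real
        logarithms without any branch ambiguity; the powers of \<open>p\<close> cancel.\<close>
      have p: "complex_of_real p = exp (of_real (ln p))" and t': "complex_of_real t = exp (of_real (ln t))"
        using t assms(2) by (simp_all add: exp_of_real)
      have "of_real p powr (- \<sigma>) * of_real p * of_real t * of_real (p * t\<^sup>2) powr (\<sigma> - 1)
        = exp (- \<sigma> * of_real (ln p)) * exp (of_real (ln p)) * exp (of_real (ln t)) * exp ((\<sigma> - 1) * of_real (ln (p * t\<^sup>2)))"
        using t assms(2) by (simp add: powr_def Ln_of_real p[symmetric] t'[symmetric] del: of_real_mult of_real_power)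
      also have "\<dots> = exp ((2 * \<sigma> - 1) * of_real (ln t))"
        using t assms(2) by (simp add: ln_mult ln_realpow algebra_simps flip: exp_add)
      also have "\<dots> = of_real t powr (2 * \<sigma> - 1)"
        using t by (simp add: powr_def Ln_of_real)
      finally show ?thesis .
    qed
    finally show ?thesis by (simp add: f_def)
  qed
  have "(\<lambda>t. of_real p powr (- \<sigma>) / 2 * (\<bar>2 * p * t\<bar> *\<^sub>R h (g t))) absolutely_integrable_on {0<..}"
    using * by (intro set_integrable_mult_right) auto
  then show "f absolutely_integrable_on {0<..}"
    by (rule iffD1[OF set_integrable_cong[OF refl refl], rotated]) (rule eq)
  have "((\<lambda>t. \<bar>2 * p * t\<bar> *\<^sub>R h (g t)) has_integral Gamma \<sigma>) {0<..}"
    using integrable_integral[OF set_lebesgue_integral_eq_integral(1)[OF *(1)]] unfolding *(2) .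
  from has_integral_mult_right[OF this, of "of_real p powr (- \<sigma>) / 2"]
  have "((\<lambda>t. of_real p powr (- \<sigma>) / 2 * (\<bar>2 * p * t\<bar> *\<^sub>R h (g t)))
     has_integral (of_real p powr (- \<sigma>) / 2 * Gamma \<sigma>)) {0<..}" .
  then have "(f has_integral (of_real p powr (- \<sigma>) / 2 * Gamma \<sigma>)) {0<..}"
    by (rule has_integral_eq[rotated]) (rule eq)
  then show "(f has_integral Gamma \<sigma> * of_real p powr (- \<sigma>) / 2) {0<..}"
    by (simp add: mult.commute)
qed

text \<open>Since |t^(2 \<sigma> - 1)| = t^(2 Re \<sigma> - 1) for t > 0, this is the moment at the
  real exponent Re \<sigma>. It controls the sum of the integrals of norms.\<close>

lemma gaussian_moment_norm:
  fixes \<sigma> :: complex and p :: real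
  assumes "Re \<sigma> > 0" "p > 0"
  shows "((\<lambda>t::real. norm (of_real t powr (2 * \<sigma> - 1) * complex_of_real (exp (- p * t\<^sup>2))))
           has_integral Gamma (Re \<sigma>) * p powr (- Re \<sigma>) / 2) {0<..}"
proof -
  have "((\<lambda>t::real. Re (of_real t powr (2 * of_real (Re \<sigma>) - 1) * complex_of_real (exp (- p * t\<^sup>2))))
           has_integral Re (Gamma (of_real (Re \<sigma>)) * of_real p powr (- of_real (Re \<sigma>)) / 2)) {0<..}"
    using gaussian_moment(2)[of "of_real (Re \<sigma>)" p] assms
    by (intro has_integral_linear[OF _ bounded_linear_Re, unfolded o_def]) auto
  also have "of_real p powr (- of_real (Re \<sigma>)) = complex_of_real (p powr (- Re \<sigma>))"
    using assms powr_of_real[of p "- Re \<sigma>"] by simp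
  finally have "((\<lambda>t::real. Re (of_real t powr (2 * of_real (Re \<sigma>) - 1) * complex_of_real (exp (- p * t\<^sup>2))))
           has_integral Gamma (Re \<sigma>) * p powr (- Re \<sigma>) / 2) {0<..}"
    by (simp add: Gamma_complex_of_real)
  then show ?thesis
  proof (rule has_integral_cong[THEN iffD1, rotated])
    fix t :: real assume "t \<in> {0<..}"
    then have t: "t > 0" by simp
    have "of_real t powr (2 * of_real (Re \<sigma>) - 1) = complex_of_real (t powr (2 * Re \<sigma> - 1))"
      using t powr_of_real[of t "2 * Re \<sigma> - 1"] by simp
    then show "Re (of_real t powr (2 * of_real (Re \<sigma>) - 1) * complex_of_real (exp (- p * t\<^sup>2))) =
       norm (of_real t powr (2 * \<sigma> - 1) * complex_of_real (exp (- p * t\<^sup>2)))"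
      using t by (simp add: norm_mult norm_powr_real_powr)
  qed
qed

text \<open>Absolute convergence, pointwise and in the mean, permits exchanging sum and integral;
  the exchange is made for the Lebesgue integral and carried back.\<close>

lemma has_integral_suminf:
  fixes f :: "nat \<Rightarrow> 'a::euclidean_space \<Rightarrow> 'b::euclidean_space"
  assumes "\<And>n. f n absolutely_integrable_on S" "S \<in> sets lebesgue"
    and "\<And>x. x \<in> S \<Longrightarrow> summable (\<lambda>n. norm (f n x))"
    and "summable (\<lambda>n. integral S (\<lambda>x. norm (f n x)))"
  shows "((\<lambda>x. \<Sum>n. f n x) has_integral (\<Sum>n. integral S (f n))) S"
proof -
  have int: "integrable (lebesgue_on S) (f n)" for n
    by (rule absolutely_integrable_imp_integrable assms)+
  have AE: "AE x in lebesgue_on S. summable (\<lambda>n. norm (f n x))"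
    using assms(3) by (intro AE_I2) (simp add: space_restrict_space)
  have sum: "summable (\<lambda>n. \<integral>x. norm (f n x) \<partial>lebesgue_on S)"
    using assms(4) integrable_norm[OF int] assms(2) by (simp add: lebesgue_integral_eq_integral)
  have "((\<lambda>x. \<Sum>n. f n x) has_integral (\<integral>x. (\<Sum>n. f n x) \<partial>lebesgue_on S)) S"
    by (intro has_integral_integral_lebesgue_on integrable_suminf int AE sum assms)
  also have "(\<integral>x. (\<Sum>n. f n x) \<partial>lebesgue_on S) = (\<Sum>n. integral S (f n))"
    using integral_suminf[OF int AE sum] int assms(2) by (simp add: lebesgue_integral_eq_integral)
  finally show ?thesis .
qed

text \<open>Factorwise 0 \<le> Re s + i \<le> |s + i|. The moments of norms bring in the symbol of
  Re \<sigma>, the coefficients the reciprocal symbol of \<sigma>; their product therefore stays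
  bounded.\<close>

lemma pochhammer_Re_le_norm:
  assumes "Re s \<ge> 0"
  shows "0 \<le> pochhammer (Re s) n" "pochhammer (Re s) n \<le> norm (pochhammer s n)"
proof -
  show nn: "0 \<le> pochhammer (Re s) n"
    using assms by (auto simp: pochhammer_prod intro!: prod_nonneg)
  have "pochhammer (Re s) n \<le> (\<Prod>i<n. norm (s + of_nat i))"
    unfolding pochhammer_prod atLeast0LessThan
  proof (rule prod_mono, intro conjI)
    fix i
    show "0 \<le> Re s + of_nat i" using assms by simp
    show "Re s + of_nat i \<le> norm (s + of_nat i)" using complex_Re_le_cmod[of "s + of_nat i"] by simp
  qed
  then show "pochhammer (Re s) n \<le> norm (pochhammer s n)"
    by (simp add: pochhammer_prod prod_norm atLeast0LessThan)
qed

text \<open>Termwise integration removes the lower parameter \<open>\<sigma>\<close>, because the \<open>n\<close>-th moment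
  contributes \<open>\<Gamma>(\<sigma> + n)\<close>.\<close>
lemma hypergeo_2F2_gaussian_integral:
  fixes \<alpha> \<beta> \<gamma> \<sigma> :: complex and p q :: real
  assumes \<sigma>: "Re \<sigma> > 0" and pq: "0 \<le> q" "q < p"
  shows "((\<lambda>t::real. of_real t powr (2 * \<sigma> - 1) * of_real (exp (- p * t\<^sup>2))
             * hypergeo_2F2 \<alpha> \<beta> \<gamma> \<sigma> (of_real (q * t\<^sup>2)))
          has_integral Gamma \<sigma> * of_real p powr (- \<sigma>) / 2 * hypergeo_2F1 \<alpha> \<beta> \<gamma> (of_real (q / p)))
         {0<..}"
proof -
  have p: "p > 0" using pq by simp
  define h where "h = fps_nth (fps_hypergeo [\<alpha>, \<beta>] [\<gamma>, \<sigma>] 1)"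
  define H where "H = fps_nth (fps_hypergeo [\<alpha>, \<beta>] [\<gamma>] 1)"
  \<comment> \<open>The factor t^(2 n) of the n-th term is absorbed by shifting \<sigma> to \<sigma>
    + n.\<close>
  define G where "G = (\<lambda>n (t::real). of_real t powr (2 * (\<sigma> + of_nat n) - 1) * complex_of_real (exp (- p * t\<^sup>2)))"
  define f where "f = (\<lambda>n t. h n * of_real (q ^ n) * G n t)"
  have \<sigma>0: "\<sigma> \<notin> \<int>\<^sub>\<le>\<^sub>0" using \<sigma> by (auto elim!: nonpos_Ints_cases)
  have poch: "pochhammer \<sigma> n \<noteq> 0" for n
    using \<sigma>0 by (auto simp: pochhammer_eq_0_iff)
  have hH: "h n * pochhammer \<sigma> n = H n" for n
    using poch by (simp add: h_def H_def)
  have \<sigma>n: "Re (\<sigma> + of_nat n) > 0" for n using \<sigma> by simp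
  have f_eq: "f n t = of_real t powr (2 * \<sigma> - 1) * of_real (exp (- p * t\<^sup>2)) * (h n * of_real (q * t\<^sup>2) ^ n)"
    if "t \<in> {0<..}" for n t
  proof -
    have t: "t > 0" using that by simp
    have "of_real t powr (2 * (\<sigma> + of_nat n) - 1) = of_real t powr ((2 * \<sigma> - 1) + of_nat (2 * n))"
      by (simp add: algebra_simps)
    also have "\<dots> = of_real t powr (2 * \<sigma> - 1) * complex_of_real t ^ (2 * n)"
      using t by (subst powr_add, subst powr_nat') auto
    also have "complex_of_real t ^ (2 * n) = of_real (t\<^sup>2) ^ n"
      by (simp add: power_mult)
    finally show ?thesis
      by (simp add: f_def G_def power_mult_distrib mult_ac)
  qed
  have G1: "G n absolutely_integrable_on {0<..}" and
    G2: "(G n has_integral Gamma (\<sigma> + of_nat n) * of_real p powr (- (\<sigma> + of_nat n)) / 2) {0<..}" and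
    G3: "((\<lambda>t. norm (G n t)) has_integral Gamma (Re \<sigma> + n) * p powr (- (Re \<sigma> + n)) / 2) {0<..}" for n
    unfolding G_def using gaussian_moment[OF \<sigma>n p, of n] gaussian_moment_norm[OF \<sigma>n p, of n] by simp_all
  have f1: "f n absolutely_integrable_on {0<..}" for n
    unfolding f_def using G1 by (intro set_integrable_mult_right)
  have f2: "integral {0<..} (f n) = Gamma \<sigma> * of_real p powr (- \<sigma>) / 2 * (H n * of_real (q / p) ^ n)" for n
  proof -
    have "integral {0<..} (f n) = h n * of_real (q ^ n) * (Gamma (\<sigma> + of_nat n) * of_real p powr (- (\<sigma> + of_nat n)) / 2)"
      unfolding f_def by (intro integral_unique has_integral_mult_right G2)
    also have "Gamma (\<sigma> + of_nat n) = pochhammer \<sigma> n * Gamma \<sigma>"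
      using pochhammer_Gamma[OF \<sigma>0, of n] Gamma_eq_zero_iff[of \<sigma>] \<sigma>0 by simp
    also have "of_real p powr (- (\<sigma> + of_nat n)) = of_real p powr (- \<sigma>) / of_real p ^ n"
      using p powr_diff[of "of_real p" "- \<sigma>" "of_nat n"] by (simp add: powr_nat')
    finally show ?thesis by (simp add: power_divide mult_ac flip: hH)
  qed
  \<comment> \<open>The norms of the \<open>2F2\<close> terms integrate to at most a constant times
    the norms of the \<open>2F1\<close> terms, which supplies the majorant.\<close>
  have f3: "integral {0<..} (\<lambda>t. norm (f n t))
      \<le> Gamma (Re \<sigma>) * p powr (- Re \<sigma>) / 2 * norm (H n * of_real (q / p) ^ n)" for n
  proof -
    have \<sigma>0': "Re \<sigma> \<notin> \<int>\<^sub>\<le>\<^sub>0" using \<sigma> by (auto elim!: nonpos_Ints_cases)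
    have "integral {0<..} (\<lambda>t. norm (f n t)) = norm (h n * of_real (q ^ n)) * (Gamma (Re \<sigma> + n) * p powr (- (Re \<sigma> + n)) / 2)"
      unfolding f_def norm_mult[of _ "G n _"] by (intro integral_unique has_integral_mult_right G3)
    also have "Gamma (Re \<sigma> + n) = pochhammer (Re \<sigma>) n * Gamma (Re \<sigma>)"
      using pochhammer_Gamma[OF \<sigma>0', of n] Gamma_real_pos[OF \<sigma>] by simp
    also have "p powr (- (Re \<sigma> + n)) = p powr (- Re \<sigma>) / p ^ n"
      using p powr_diff[of p "- Re \<sigma>" "of_nat n"] by (simp add: powr_realpow)
    also have "norm (h n * of_real (q ^ n)) * (pochhammer (Re \<sigma>) n * Gamma (Re \<sigma>) * (p powr (- Re \<sigma>) / p ^ n) / 2)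
        = Gamma (Re \<sigma>) * p powr (- Re \<sigma>) / 2 * (norm (h n) * (q / p) ^ n * pochhammer (Re \<sigma>) n)"
      using pq by (simp add: norm_mult norm_power power_divide mult_ac)
    also have "\<dots> \<le> Gamma (Re \<sigma>) * p powr (- Re \<sigma>) / 2 * (norm (h n) * (q / p) ^ n * norm (pochhammer \<sigma> n))"
      using pochhammer_Re_le_norm[of \<sigma> n] \<sigma> pq p Gamma_real_pos[OF \<sigma>]
      by (intro mult_left_mono) auto
    also have "\<dots> = Gamma (Re \<sigma>) * p powr (- Re \<sigma>) / 2 * norm (H n * of_real (q / p) ^ n)"
      using pq p by (simp add: norm_mult norm_power norm_divide mult_ac flip: hH)
    finally show ?thesis .
  qed
  \<comment> \<open>Here q < p enters: it places the argument of the \<open>2F1\<close> in the unit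
    disc.\<close>
  have qp: "norm (complex_of_real (q / p)) < 1" using pq p by (simp add: norm_divide)
  have H_summable: "summable (\<lambda>n. norm (H n * of_real (q / p) ^ n))"
    using summable_norm_hypergeo_2F1[OF qp] unfolding H_def .
  have h_summable: "summable (\<lambda>n. norm (h n * z ^ n))" for z
    using summable_norm_hypergeo_2F2 unfolding h_def .
  have "((\<lambda>t. \<Sum>n. f n t) has_integral (\<Sum>n. integral {0<..} (f n))) {0<..}"
  proof (rule has_integral_suminf[OF f1])
    show "summable (\<lambda>n. norm (f n t))" if "t \<in> {0<..}" for t
      unfolding f_eq[OF that] norm_mult[of "_ * _"] by (intro summable_mult h_summable)
    show "summable (\<lambda>n. integral {0<..} (\<lambda>t. norm (f n t)))"
    proof (rule summable_comparison_test)
      show "summable (\<lambda>n. Gamma (Re \<sigma>) * p powr (- Re \<sigma>) / 2 * norm (H n * of_real (q / p) ^ n))"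
        by (intro summable_mult H_summable)
      have "0 \<le> integral {0<..} (\<lambda>t. norm (f n t))" for n
        using f1 by (intro integral_nonneg) (auto simp: absolutely_integrable_on_def)
      then show "\<exists>N. \<forall>n\<ge>N. norm (integral {0<..} (\<lambda>t. norm (f n t)))
          \<le> Gamma (Re \<sigma>) * p powr (- Re \<sigma>) / 2 * norm (H n * of_real (q / p) ^ n)"
        using f3 by auto
    qed
  qed simp
  also have "(\<Sum>n. integral {0<..} (f n)) = Gamma \<sigma> * of_real p powr (- \<sigma>) / 2 * (\<Sum>n. H n * of_real (q / p) ^ n)"
    unfolding f2 by (intro suminf_mult summable_norm_cancel[OF H_summable])
  also have "(\<Sum>n. H n * of_real (q / p) ^ n) = hypergeo_2F1 \<alpha> \<beta> \<gamma> (of_real (q / p))"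
    by (simp only: H_def hypergeo_def eval_fps_def)
  finally show ?thesis
  proof (rule has_integral_cong[THEN iffD1, rotated])
    fix t :: real assume t: "t \<in> {0<..}"
    have "(\<Sum>n. f n t) = of_real t powr (2 * \<sigma> - 1) * of_real (exp (- p * t\<^sup>2)) * (\<Sum>n. h n * of_real (q * t\<^sup>2) ^ n)"
      unfolding f_eq[OF t] by (intro suminf_mult summable_norm_cancel[OF h_summable])
    then show "(\<Sum>n. f n t) = of_real t powr (2 * \<sigma> - 1) * of_real (exp (- p * t\<^sup>2))
             * hypergeo_2F2 \<alpha> \<beta> \<gamma> \<sigma> (of_real (q * t\<^sup>2))"
      by (simp only: h_def hypergeo_def eval_fps_def)
  qed
qed

section \<open>Assembly of the integral formula\<close>

lemma hypergeo_2F1_mean_parameter: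
  fixes a b :: complex and w :: real
  assumes c: "(a + b) / 2 \<notin> \<int>\<^sub>\<le>\<^sub>0" and w: "0 \<le> w" "w < 1 / 2"
  shows "of_real (1 - 2 * w) * hypergeo_2F1 a b ((a + b) / 2) (of_real w)
     = hypergeo_2F1 (a / 2) ((b - 1) / 2) ((a + b) / 2) (of_real (4 * w * (1 - w)))
       - b / (a + b) * of_real (2 * w)
         * hypergeo_2F1 (a / 2) ((b + 1) / 2) (1 + (a + b) / 2) (of_real (4 * w * (1 - w)))"
proof -
  have c1: "1 + (a + b) / 2 \<notin> \<int>\<^sub>\<le>\<^sub>0"
    using c plus_one_in_nonpos_Ints_imp[of "(a + b) / 2"] by (auto simp: add.commute)
  have par: "(a + (b - 1) + 1) / 2 = (a + b) / 2" "(a + (b + 1) + 1) / 2 = 1 + (a + b) / 2"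
    by (simp_all add: field_simps)
  have "hypergeo_2F1 a (b - 1) ((a + b) / 2) (of_real w)
      = hypergeo_2F1 (a / 2) ((b - 1) / 2) ((a + b) / 2) (of_real (4 * w * (1 - w)))"
    using hypergeo_2F1_quadratic[of a "b - 1" w] c w unfolding par by blast
  moreover have "hypergeo_2F1 a (b + 1) (1 + (a + b) / 2) (of_real w)
      = hypergeo_2F1 (a / 2) ((b + 1) / 2) (1 + (a + b) / 2) (of_real (4 * w * (1 - w)))"
    using hypergeo_2F1_quadratic[of a "b + 1" w] c1 w unfolding par by blast
  moreover have "(1 - 2 * of_real w) * hypergeo_2F1 a b ((a + b) / 2) (of_real w)
      = hypergeo_2F1 a (b - 1) ((a + b) / 2) (of_real w)
        - 2 * b / (a + b) * of_real w * hypergeo_2F1 a (b + 1) (1 + (a + b) / 2) (of_real w)"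
    using hypergeo_2F1_contiguous[OF c, of "of_real w"] w by (simp add: add.commute[of 1])
  ultimately show ?thesis by simp
qed

theorem mainTheorem11:
  fixes \<mu> \<nu> :: complex and x y :: real
  assumes "Re (\<mu> + \<nu>) < 1" and "\<mu> + \<nu> \<noteq> 0" and "x > 0" and "y > 0"
  shows "((\<lambda>t::real. complex_of_real t powr (- (\<mu> + \<nu>))
            * complex_of_real (exp (- ((x + y) / (4 * x * y)) * t\<^sup>2))
            * hypergeo_2F2 (- \<mu>) (- \<nu>) (- (\<mu> + \<nu>) / 2) ((1 - \<mu> - \<nu>) / 2)
                (complex_of_real (t\<^sup>2 / (8 * x))))
          has_integral
          2 powr (- (\<mu> + \<nu>)) * Gamma ((1 - \<mu> - \<nu>) / 2) * complex_of_real y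
            * complex_of_real ((x + y) / (x * y)) powr ((1 + \<mu> + \<nu>) / 2)
            * (hypergeo_2F1 (- \<mu> / 2) (- (1 + \<nu>) / 2) (- (\<mu> + \<nu>) / 2)
                 (complex_of_real (y * (2 * x + y) / (x + y)\<^sup>2))
               - \<nu> * complex_of_real y / ((\<mu> + \<nu>) * complex_of_real (x + y))
                 * hypergeo_2F1 (- \<mu> / 2) ((1 - \<nu>) / 2) (1 - (\<mu> + \<nu>) / 2)
                     (complex_of_real (y * (2 * x + y) / (x + y)\<^sup>2))))
         {0<..}"
proof -
  define s where "s = \<mu> + \<nu>"
  define \<sigma> where "\<sigma> = (1 - \<mu> - \<nu>) / 2"
  define p where "p = (x + y) / (4 * x * y)"
  define Q where "Q = (x + y) / (x * y)"
  \<comment> \<open>The quotient of 1/(8 x) by \<open>p\<close>, at which termwise integration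
    evaluates the \<open>2F1\<close>; then 4 w (1 - w) is the argument \<open>z\<close>.\<close>
  define w where "w = y / (2 * (x + y))"
  define z where "z = y * (2 * x + y) / (x + y)\<^sup>2"
  define R where "R = hypergeo_2F1 (- \<mu> / 2) (- (1 + \<nu>) / 2) (- (\<mu> + \<nu>) / 2) (of_real z)
     - \<nu> * complex_of_real y / ((\<mu> + \<nu>) * complex_of_real (x + y))
                 * hypergeo_2F1 (- \<mu> / 2) ((1 - \<nu>) / 2) (1 - (\<mu> + \<nu>) / 2) (of_real z)"
  have xy: "x + y > 0" "x > 0" "y > 0" "Q > 0" "p > 0" using assms by (simp_all add: Q_def p_def)
  have p_Q: "p = Q / 4" by (simp add: p_def Q_def)
  have q: "1 / (8 * x) < p"
    using xy by (simp add: p_def field_simps)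
  have w_eq: "1 / (8 * x) / p = w" using xy by (simp add: p_def w_def field_simps)
  have w: "0 \<le> w" "w < 1 / 2" using xy by (simp_all add: w_def field_simps)
  have "1 - w = (2 * x + y) / (2 * (x + y))" using xy by (simp add: w_def field_simps)
  moreover have "4 * (y / (2 * u)) * (k / (2 * u)) = y * k / u\<^sup>2" for k u :: real
    by (simp add: power2_eq_square)
  ultimately have z_eq: "4 * w * (1 - w) = z"
    unfolding z_def by (simp only: w_def)
  \<comment> \<open>This trades the factor 1 - 2 w from the contiguous relation for the prefactor
    \<open>y\<close> and one extra power of \<open>Q\<close>.\<close>
  have y_eq: "y * (1 - 2 * w) = 1 / Q"
    using xy by (simp add: w_def Q_def field_simps)
  have c: "(- \<mu> + - \<nu>) / 2 \<notin> \<int>\<^sub>\<le>\<^sub>0"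
  proof
    assume "(- \<mu> + - \<nu>) / 2 \<in> \<int>\<^sub>\<le>\<^sub>0"
    then obtain n where n: "(- \<mu> + - \<nu>) / 2 = - of_nat n" by (rule nonpos_Ints_cases')
    then have eq: "\<mu> + \<nu> = 2 * of_nat n" by (simp add: field_simps)
    \<comment> \<open>Re (\<mu> + \<nu>) < 1 rules out every positive even integer, and \<mu> +
      \<nu> \<noteq> 0 rules out the remaining case.\<close>
    then have "n = 0" using assms(1) by (auto simp: eq)
    with eq assms(2) show False by simp
  qed
  have F: "of_real (1 - 2 * w) * hypergeo_2F1 (- \<mu>) (- \<nu>) (- (\<mu> + \<nu>) / 2) (of_real w) = R"
  proof -
    have par: "(- \<mu> + - \<nu>) / 2 = - (\<mu> + \<nu>) / 2" "(- \<nu> - 1) / 2 = - (1 + \<nu>) / 2"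
      "(- \<nu> + 1) / 2 = (1 - \<nu>) / 2" "1 + - (\<mu> + \<nu>) / 2 = 1 - (\<mu> + \<nu>) / 2"
      by (simp_all add: field_simps)
    have coeff: "- \<nu> / (- \<mu> + - \<nu>) * of_real (2 * w) = \<nu> * of_real y / ((\<mu> + \<nu>) * of_real (x + y))"
    proof -
      have "- \<nu> / (- \<mu> + - \<nu>) = \<nu> / (\<mu> + \<nu>)"
        using minus_divide_divide[of \<nu> "\<mu> + \<nu>"] by simp
      moreover have "2 * w = y / (x + y)" using xy by (simp add: w_def field_simps)
      ultimately show ?thesis by simp
    qed
    show ?thesis
      using hypergeo_2F1_mean_parameter[OF c w] unfolding coeff z_eq unfolding par R_def .
  qed
  \<comment> \<open>As p = Q/4, p^(-\<sigma>) contributes 4^\<sigma> = 2^(1 - s), halved to 2^(-s),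
    and Q^(-\<sigma>) = Q^((1 + s)/2) / Q, where 1/Q = y (1 - 2 w).\<close>
  have const: "of_real p powr (- \<sigma>) / 2 = 2 powr (- s) * of_real y * of_real (1 - 2 * w) * of_real Q powr ((1 + s) / 2)"
  proof -
    have "of_real y * of_real (1 - 2 * w) = inverse (complex_of_real Q)"
      using arg_cong[OF y_eq, of complex_of_real] by (simp add: divide_inverse)
    moreover have "of_real Q powr ((1 + s) / 2) = of_real Q * complex_of_real Q powr (- \<sigma>)"
    proof -
      have half: "(1 + s) / 2 = 1 + (- \<sigma>)" by (simp add: \<sigma>_def s_def field_simps)
      show ?thesis
        unfolding half using xy powr_add[of "of_real Q" 1 "- \<sigma>"] by simp
    qed
    moreover have "of_real p powr (- \<sigma>) = of_real Q powr (- \<sigma>) * (2 * 2 powr (- s))"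
    proof -
      have two_\<sigma>: "2 * \<sigma> = 1 - s" by (simp add: \<sigma>_def s_def)
      have "of_real p powr (- \<sigma>) = exp (- \<sigma> * of_real (ln p))"
        using xy by (simp add: powr_def Ln_of_real)
      also have "ln p = ln Q - 2 * ln 2"
        using xy ln_realpow[of 2 2] by (simp add: p_Q ln_div)
      also have "exp (- \<sigma> * of_real (ln Q - 2 * ln 2)) = exp (- \<sigma> * of_real (ln Q)) * exp (2 * \<sigma> * of_real (ln 2))"
        by (simp add: algebra_simps flip: exp_add)
      also have "2 * \<sigma> * of_real (ln 2) = - s * of_real (ln 2) + of_real (ln 2)"
        unfolding two_\<sigma> by (simp add: algebra_simps)
      also have "exp (- s * of_real (ln 2) + of_real (ln 2)) = 2 * exp (- s * of_real (ln 2))"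
        unfolding exp_add exp_of_real by simp
      also have "exp (- s * of_real (ln 2)) = 2 powr (- s)"
        using Ln_of_real[of 2] by (simp add: powr_def)
      also have "exp (- \<sigma> * of_real (ln Q)) = of_real Q powr (- \<sigma>)"
        using xy by (simp add: powr_def Ln_of_real)
      finally show ?thesis .
    qed
    ultimately show ?thesis using xy by (simp add: mult_ac)
  qed
  have main: "((\<lambda>t::real. of_real t powr (2 * \<sigma> - 1) * of_real (exp (- p * t\<^sup>2))
             * hypergeo_2F2 (- \<mu>) (- \<nu>) (- (\<mu> + \<nu>) / 2) \<sigma> (of_real (1 / (8 * x) * t\<^sup>2)))
          has_integral Gamma \<sigma> * of_real p powr (- \<sigma>) / 2
             * hypergeo_2F1 (- \<mu>) (- \<nu>) (- (\<mu> + \<nu>) / 2) (of_real (1 / (8 * x) / p))) {0<..}"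
    using assms xy q by (intro hypergeo_2F2_gaussian_integral) (auto simp: \<sigma>_def)
  have exponent: "2 * \<sigma> - 1 = - (\<mu> + \<nu>)" by (simp add: \<sigma>_def field_simps)
  have rhs: "Gamma \<sigma> * of_real p powr (- \<sigma>) / 2
       * hypergeo_2F1 (- \<mu>) (- \<nu>) (- (\<mu> + \<nu>) / 2) (of_real w)
     = 2 powr (- s) * Gamma \<sigma> * of_real y * of_real Q powr ((1 + s) / 2) * R"
    unfolding F[symmetric] using const by (simp add: mult_ac)
  have arg: "1 / (8 * x) * t\<^sup>2 = t\<^sup>2 / (8 * x)" for t by simp
  have power: "(1 + s) / 2 = (1 + \<mu> + \<nu>) / 2" by (simp add: s_def)
  show ?thesis
    using main unfolding w_eq exponent rhs arg unfolding power
    unfolding R_def s_def Q_def p_def \<sigma>_def z_def .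
qed

end
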